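(* Let $G=(X\cup Y,E)$ be a bipartite graph that is subset-uniform with respect to the partition $\mathcal{I}$ of $X$, with dependency graph $\mathcal{G}=(\mathcal{I}\cup Y,\mathcal{E})$. Let $m\ge 2$, let $\{I_1,j_1\},\{j_1,I_2\},\{I_2,j_2\},\ldots,\{I_m,j_m\},\{j_m,I_1\}\in\mathcal{E}$ be the edges of a simple chordless cycle of length $2m$ in $\mathcal{G}$ (with $I_1,\ldots,I_m\in\mathcal{I}$ pairwise distinct and $j_1,\ldots,j_m\in Y$ pairwise distinct), and let $S_1\subseteq I_1,\ldots,S_m\subseteq I_m$ be non-empty. Then the inequality $$\sum_{i\in S_1}\left(-z_{ij_1}+z_{ij_m}\right)+\sum_{p=2}^m\left(-y_{j_p}+\sum_{i\in S_p}\left(-x_i+z_{ij_{p-1}}+z_{ij_p}\right)\right)\le 0,$$ as well as every switching of it, defines a facet of $P(G,\mathcal{I})$.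
   Context: $G=(X\cup Y,E)$ is a finite bipartite graph with disjoint node sets $X,Y$; every edge $\{i,j\}\in E$ has $i\in X$, $j\in Y$. $\mathcal{I}$ is a partition of $X$ into non-empty subsets. $N(v)$ is the set of neighbours of $v$. Vectors in $\mathbb{R}^{X\cup Y\cup E}$ are written $(x,y,z)$. Put $X^{\mathcal{I}}=\{x\in\{0,1\}^X : \sum_{i\in I}x_i\le 1\ \forall I\in\mathcal{I}\}$ and $$P(G,\mathcal{I})=\operatorname{conv}\{(x,y,z)\in\{0,1\}^{X\cup Y\cup E} : x_iy_j=z_{ij}\ \forall\{i,j\}\in E,\ x\in X^{\mathcal{I}}\},$$ which is a full-dimensional polytope. $G$ is subset-uniform with respect to $\mathcal{I}$ if any two nodes in the same subset $I\in\mathcal{I}$ have the same neighbourhood in $Y$. For such $G$, the dependency graph is $\mathcal{G}=(\mathcal{I}\cup Y,\mathcal{E})$, where $\{I,j\}\in\mathcal{E}$ iff $j$ belongs to the common neighbourhood of the nodes in $I$. A cycle is chordless if no edge of $\mathcal{G}$ other than those of the cycle joins two of its nodes. Switching: for an inequality $a^T(x,y,z)\le b$ and $\hat Y\subseteq Y$, the switching on $\hat Y$ is the inequality $\hat a^T(x,y,z)\le\hat b$ with $\hat a_i=a_i+\sum_{j\in\hat Y\cap N(i)}a_{ij}$ for $i\in X$; $\hat a_j=-a_j$ for $j\in\hat Y$, $\hat a_j=a_j$ for $j\in Y\setminus\hat Y$; $\hat a_{ij}=-a_{ij}$ for $\{i,j\}\in E$ with $j\in\hat Y$, $\hat a_{ij}=a_{ij}$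 for all other edges; $\hat b=b-\sum_{j\in\hat Y}a_j$. *)

theory Defs
  imports "HOL-Analysis.Analysis" "HOL-Library.Disjoint_Sets"
begin

text \<open>
  A finite simple bipartite graph \<open>G = (X \<union> Y, E)\<close> is given by finite types \<open>'x\<close>, \<open>'y\<close>, \<open>'e\<close>
  of \<open>X\<close>-nodes, \<open>Y\<close>-nodes and edges, and by an injective map \<open>ends\<close> sending each edge to its pair
  of endpoints; thus \<open>range ends\<close> is the edge set.
  Since \<open>E\<close> is a type of its own, \<open>(real^'x) \<times> (real^'y) \<times> (real^'e)\<close> is exactly the Euclidean
  space with coordinate set \<open>X \<union> Y \<union> E\<close>, whose vectors are written \<open>(x, y, z)\<close>.
\<close>

type_synonym ('x, 'y, 'e) vec3 = "(real^'x) \<times> (real^'y) \<times> (real^'e)"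

definition nbrs :: "('e \<Rightarrow> 'x \<times> 'y) \<Rightarrow> 'x \<Rightarrow> 'y set" where
  "nbrs ends i = {j. (i, j) \<in> range ends}"

text \<open>The edge with endpoints \<open>i\<close> and \<open>j\<close>; only meaningful if \<open>j \<in> nbrs ends i\<close>.\<close>

definition edge :: "('e \<Rightarrow> 'x \<times> 'y) \<Rightarrow> 'x \<Rightarrow> 'y \<Rightarrow> 'e" where
  "edge ends i j = inv ends (i, j)"

lemma edge_ends: "inj ends \<Longrightarrow> edge ends (fst (ends e)) (snd (ends e)) = e"
  by (simp add: edge_def)

lemma ends_edge: "j \<in> nbrs ends i \<Longrightarrow> ends (edge ends i j) = (i, j)"
  by (simp add: edge_def nbrs_def f_inv_into_f)

definition X_set :: "'x::finite set set \<Rightarrow> (real^'x) set" where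
  "X_set \<I> = {x. (\<forall>i. x $ i \<in> {0, 1}) \<and> (\<forall>I\<in>\<I>. (\<Sum>i\<in>I. x $ i) \<le> 1)}"

definition P_poly :: "('e::finite \<Rightarrow> 'x::finite \<times> 'y::finite) \<Rightarrow> 'x set set \<Rightarrow> ('x, 'y, 'e) vec3 set" where
  "P_poly ends \<I> = convex hull
     {(x, y, z). x \<in> X_set \<I> \<and> (\<forall>j. y $ j \<in> {0, 1}) \<and> (\<forall>e. z $ e \<in> {0, 1}) \<and>
                 (\<forall>e. x $ fst (ends e) * y $ snd (ends e) = z $ e)}"

definition subset_uniform :: "('e \<Rightarrow> 'x \<times> 'y) \<Rightarrow> 'x set set \<Rightarrow> bool" where
  "subset_uniform ends \<I> \<longleftrightarrow> (\<forall>I\<in>\<I>. \<forall>i\<in>I. \<forall>i'\<in>I. nbrs ends i = nbrs ends i')"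

text \<open>The dependency graph is bipartite with node classes \<open>\<I>\<close> and \<open>Y\<close>, so an edge
  \<open>{I, j}\<close> is encoded as the pair \<open>(I, j)\<close>.\<close>

definition dep_edges :: "('e \<Rightarrow> 'x \<times> 'y) \<Rightarrow> 'x set set \<Rightarrow> ('x set \<times> 'y) set" where
  "dep_edges ends \<I> = {(I, j). I \<in> \<I> \<and> (\<forall>i\<in>I. j \<in> nbrs ends i)}"

text \<open>The edges of the closed walk \<open>I 1, j 1, I 2, j 2, \<dots>, I m, j m, I 1\<close>.\<close>

definition cycle_edges :: "nat \<Rightarrow> (nat \<Rightarrow> 'a) \<Rightarrow> (nat \<Rightarrow> 'b) \<Rightarrow> ('a \<times> 'b) set" where
  "cycle_edges m I j = {(I p, j p) | p. p \<in> {1..m}} \<union> {(I (Suc p), j p) | p. p \<in> {1..<m}} \<union> {(I 1, j m)}"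

text \<open>As the graph \<open>F\<close> is bipartite, only pairs \<open>(I p, j q)\<close> of nodes of the cycle can be
  joined by an edge, hence can be chords.\<close>

definition simple_chordless_cycle ::
  "('a \<times> 'b) set \<Rightarrow> nat \<Rightarrow> (nat \<Rightarrow> 'a) \<Rightarrow> (nat \<Rightarrow> 'b) \<Rightarrow> bool" where
  "simple_chordless_cycle F m I j \<longleftrightarrow>
     inj_on I {1..m} \<and> inj_on j {1..m} \<and> cycle_edges m I j \<subseteq> F \<and>
     F \<inter> (I ` {1..m} \<times> j ` {1..m}) \<subseteq> cycle_edges m I j"

text \<open>A linear inequality \<open>a\<^sup>T(x,y,z) \<le> b\<close> is the pair \<open>(a, b)\<close>.\<close>

type_synonym ('x, 'y, 'e) ineq = "('x, 'y, 'e) vec3 \<times> real"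

definition defines_facet :: "'a::euclidean_space \<times> real \<Rightarrow> 'a set \<Rightarrow> bool" where
  "defines_facet ineq P \<longleftrightarrow>
     (case ineq of (a, b) \<Rightarrow> (\<forall>v\<in>P. a \<bullet> v \<le> b) \<and> {v \<in> P. a \<bullet> v = b} facet_of P)"

definition switching ::
  "('e::finite \<Rightarrow> 'x::finite \<times> 'y::finite) \<Rightarrow> 'y set \<Rightarrow> ('x, 'y, 'e) ineq \<Rightarrow> ('x, 'y, 'e) ineq" where
  "switching ends Yh ineq = (case ineq of ((ax, ay, az), b) \<Rightarrow>
     (((\<chi> i. ax $ i + (\<Sum>j\<in>Yh \<inter> nbrs ends i. az $ edge ends i j)),
       (\<chi> j. if j \<in> Yh then - ay $ j else ay $ j),
       (\<chi> e. if snd (ends e) \<in> Yh then - az $ e else az $ e)),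
      b - (\<Sum>j\<in>Yh. ay $ j)))"

text \<open>Coefficient vectors of the linear forms \<open>x\<^sub>i\<close>, \<open>y\<^sub>j\<close> and \<open>z\<^sub>i\<^sub>j\<close>.\<close>

definition xc :: "'x::finite \<Rightarrow> ('x, 'y::finite, 'e::finite) vec3" where
  "xc i = (axis i 1, 0, 0)"

definition yc :: "'y::finite \<Rightarrow> ('x::finite, 'y, 'e::finite) vec3" where
  "yc j = (0, axis j 1, 0)"

definition zc :: "('e::finite \<Rightarrow> 'x::finite \<times> 'y::finite) \<Rightarrow> 'x \<Rightarrow> 'y \<Rightarrow> ('x, 'y, 'e) vec3" where
  "zc ends i j = (0, 0, axis (edge ends i j) 1)"

definition cycle_ineq ::
  "('e::finite \<Rightarrow> 'x::finite \<times> 'y::finite) \<Rightarrow> nat \<Rightarrow> (nat \<Rightarrow> 'y) \<Rightarrow> (nat \<Rightarrow> 'x set) \<Rightarrow> ('x, 'y, 'e) ineq" where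
  "cycle_ineq ends m j S =
     ((\<Sum>i\<in>S 1. - zc ends i (j 1) + zc ends i (j m)) +
      (\<Sum>p = 2..m. - yc (j p) + (\<Sum>i\<in>S p. - xc i + zc ends i (j (p - 1)) + zc ends i (j p))),
      0)"

lemma xc_inner: "xc i \<bullet> (x, y, z) = x $ i"
  and yc_inner: "yc j \<bullet> (x, y, z) = y $ j"
  and zc_inner: "zc ends i j \<bullet> (x, y, z) = z $ edge ends i j"
  by (simp_all add: xc_def yc_def zc_def inner_axis')

lemma cycle_ineq_inner:
  "fst (cycle_ineq ends m j S) \<bullet> (x, y, z) =
     (\<Sum>i\<in>S 1. - z $ edge ends i (j 1) + z $ edge ends i (j m)) +
     (\<Sum>p = 2..m. - y $ j p +
        (\<Sum>i\<in>S p. - x $ i + z $ edge ends i (j (p - 1)) + z $ edge ends i (j p)))"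
  unfolding cycle_ineq_def fst_conv inner_add_left inner_sum_left inner_minus_left
    xc_inner yc_inner zc_inner by (rule refl)

end

theory Submission
  imports Defs
begin

text \<open>
  A vertex of \<open>P(G, \<I>)\<close> is given by a set \<open>R \<subseteq> X\<close> meeting each block at most once and a set
  \<open>T \<subseteq> Y\<close>. On it the cycle inequality depends only on whether \<open>R\<close> meets \<open>S p\<close> and whether
  \<open>j p \<in> T\<close>; a telescoping sum gives validity and a supply of tight vertices. Take a linear form
  that is constant on the tight vertices and, after subtracting a multiple of the inequality, has
  coefficient \<open>0\<close> at \<open>y\<close>-coordinate \<open>j 2\<close>. Comparing tight vertices that differ in one element
  of \<open>R\<close> or \<open>T\<close>, taken from the two families
  \<open>R = {r 2, \<dots>, r q}, T \<approx> {j 1, \<dots>, j q}\<close> and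
  \<open>R = {r 1, r (q + 1), \<dots>, r m}, T \<approx> {j q, \<dots>, j m}\<close> with \<open>r p \<in> S p\<close>,
  forces all its coefficients to vanish. So the tight face has codimension one, and \<open>P(G, \<I>)\<close> is
  full-dimensional because this face is proper. A switching evaluated at \<open>(R, T)\<close> is the original
  inequality evaluated at \<open>(R, sym_diff T Y)\<close>, so it inherits the argument.
\<close>

section \<open>Facets of a convex hull, detected by linear forms constant on the tight
  points\<close>

text \<open>The vector \<open>u\<close> removes the one degree of freedom, namely the multiples of \<open>a\<close> itself.\<close>

lemma defines_facet_convex_hullI:
  fixes a u :: "'a::euclidean_space"
  assumes valid: "\<And>v. v \<in> V \<Longrightarrow> a \<bullet> v \<le> b"
    and proper: "v\<^sub>0 \<in> V" "a \<bullet> v\<^sub>0 \<noteq> b"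
    and nonempty: "v\<^sub>1 \<in> V" "a \<bullet> v\<^sub>1 = b"
    and determined: "\<And>c d. \<lbrakk>\<And>v. \<lbrakk>v \<in> V; a \<bullet> v = b\<rbrakk> \<Longrightarrow> c \<bullet> v = d; c \<bullet> u = 0\<rbrakk> \<Longrightarrow> c = 0"
  shows "defines_facet (a, b) (convex hull V)"
proof -
  let ?P = "convex hull V" and ?F = "{v \<in> convex hull V. a \<bullet> v = b}"
  let ?D = "(\<lambda>v. v - v\<^sub>1) ` ?F"
  have valid': "a \<bullet> v \<le> b" if "v \<in> ?P" for v
  proof -
    have "?P \<subseteq> {v. a \<bullet> v \<le> b}"
      using valid by (intro hull_minimal) (auto simp: convex_halfspace_le)
    with that show ?thesis by auto
  qed
  have face: "?F face_of ?P"
    using face_of_Int_supporting_hyperplane_le[of ?P a b] valid'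
    by (auto simp: Int_def)
  have v1: "v\<^sub>1 \<in> ?F"
    using nonempty by (auto intro: hull_inc)
  \<comment> \<open>A point off the face costs the face at least one dimension. With the lower bound
    below, both dimensions are then fixed and the hull is full-dimensional.\<close>
  have "v\<^sub>0 \<in> ?P - ?F"
    using proper by (auto intro: hull_inc)
  then have "aff_dim ?F < aff_dim ?P"
    by (intro face_of_aff_dim_lt face) auto
  moreover have "aff_dim ?P \<le> int DIM('a)"
    by (rule aff_dim_le_DIM)
  moreover have "int DIM('a) - 1 \<le> aff_dim ?F"
  proof -
    \<comment> \<open>A nonzero \<open>c\<close> orthogonal to this span would be constant on the
      tight points and vanish on \<open>u\<close>, against \<open>determined\<close>. Adding
      \<open>u\<close> raises the dimension by at most one.\<close>
    have "span (insert u ?D) = UNIV"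
    proof (rule ccontr)
      assume "span (insert u ?D) \<noteq> UNIV"
      then obtain c where c: "c \<noteq> 0" "\<And>x. x \<in> span (insert u ?D) \<Longrightarrow> c \<bullet> x = 0"
        using orthogonal_to_subspace_exists[of "insert u ?D"]
        by (metis (no_types, lifting) dim_span dim_eq_full dim_subset_UNIV le_neq_implies_less
            orthogonal_def)
      have "c = 0"
      proof (rule determined)
        show "c \<bullet> u = 0" by (intro c span_base) simp
        fix v assume "v \<in> V" "a \<bullet> v = b"
        then have "v - v\<^sub>1 \<in> ?D" by (auto intro: hull_inc)
        then have "c \<bullet> (v - v\<^sub>1) = 0" by (intro c span_base) simp
        then show "c \<bullet> v = c \<bullet> v\<^sub>1" by (simp add: inner_diff_right)
      qed
      with c show False by simp
    qed
    then have "DIM('a) \<le> Suc (dim ?D)"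
      using dim_eq_full[of "insert u ?D"] dim_insert[of u ?D] by (simp split: if_splits)
    moreover have "aff_dim ?F = int (dim ?D)"
    proof -
      have "aff_dim ?F = aff_dim ((+) (- v\<^sub>1) ` ?F)"
        by (rule aff_dim_translation_eq[symmetric])
      also have "(+) (- v\<^sub>1) ` ?F = ?D"
        by simp
      also have "0 \<in> ?D"
        using v1 by force
      then have "aff_dim ?D = int (dim ?D)"
        by (intro aff_dim_zero hull_inc)
      finally show ?thesis .
    qed
    ultimately show ?thesis by linarith
  qed
  ultimately have "?F facet_of ?P"
    using face v1 by (auto simp: facet_of_def)
  with valid' show ?thesis
    by (auto simp: defines_facet_def)
qed

section \<open>Vertices as pairs of node sets, and linear forms on them\<close>

definition vertex :: "('e::finite \<Rightarrow> 'x::finite \<times> 'y::finite) \<Rightarrow> 'x set \<Rightarrow> 'y set \<Rightarrow> ('x, 'y, 'e) vec3" where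
  "vertex ends R T = ((\<chi> i. of_bool (i \<in> R)), (\<chi> j. of_bool (j \<in> T)),
     (\<chi> e. of_bool (fst (ends e) \<in> R \<and> snd (ends e) \<in> T)))"

definition indep :: "'x set set \<Rightarrow> 'x set \<Rightarrow> bool" where
  "indep \<I> R \<longleftrightarrow> (\<forall>B\<in>\<I>. \<forall>i\<in>R \<inter> B. \<forall>i'\<in>R \<inter> B. i = i')"

text \<open>The default 0 at non-edges lets the bilinear part of a form be summed over all of
  \<open>R \<times> T\<close>.\<close>

definition zcoeff :: "('e::finite \<Rightarrow> 'x::finite \<times> 'y::finite) \<Rightarrow> ('x, 'y, 'e) vec3 \<Rightarrow> 'x \<Rightarrow> 'y \<Rightarrow> real" where
  "zcoeff ends c i j = (if j \<in> nbrs ends i then snd (snd c) $ edge ends i j else 0)"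

lemma indep_empty [simp]: "indep \<I> {}"
  by (simp add: indep_def)

lemma indep_insert:
  "indep \<I> (insert i R) \<longleftrightarrow> indep \<I> R \<and> (\<forall>B\<in>\<I>. i \<in> B \<longrightarrow> R \<inter> B \<subseteq> {i})"
  unfolding indep_def by blast

text \<open>A 0/1 point is determined by the supports of \<open>x\<close> and \<open>y\<close>,
  since \<open>z\<close> is their product; a block sum is at most 1 exactly when the block contains
  at most one node of \<open>R\<close>.\<close>

lemma P_poly_eq:
  fixes ends :: "'e::finite \<Rightarrow> 'x::finite \<times> 'y::finite"
  shows "P_poly ends \<I> = convex hull {vertex ends R T |R T. indep \<I> R}"
proof -
  have card: "(\<Sum>i\<in>B. of_bool (i \<in> R)) = real (card (R \<inter> B))" for R B :: "'x set"
    by (simp add: sum.If_cases of_bool_def Int_commute)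
  have "{(x, y, z). x \<in> X_set \<I> \<and> (\<forall>j. y $ j \<in> {0, 1}) \<and> (\<forall>e. z $ e \<in> {0, 1}) \<and>
                 (\<forall>e. x $ fst (ends e) * y $ snd (ends e) = z $ e)}
      = {vertex ends R T |R T. indep \<I> R}" (is "?A = ?B")
  proof
    show "?A \<subseteq> ?B"
    proof clarify
      fix x y z
      assume x: "x \<in> X_set \<I>" and y: "\<forall>j. y $ j \<in> {0, 1}" and
        z: "\<forall>e. x $ fst (ends e) * y $ snd (ends e) = z $ e"
      let ?R = "{i. x $ i = 1}" and ?T = "{j. y $ j = 1}"
      have x': "x $ i = of_bool (i \<in> ?R)" for i
        using x by (auto simp: X_set_def)
      have y': "y $ i = of_bool (i \<in> ?T)" for i
        using y by auto
      have "(x, y, z) = vertex ends ?R ?T"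
        unfolding vertex_def
        by (simp add: vec_eq_iff x'[symmetric] y'[symmetric] flip: z)
          (metis (mono_tags, lifting) mem_Collect_eq of_bool_eq x' y')
      moreover have "indep \<I> ?R"
        unfolding indep_def
      proof (intro ballI)
        fix B i i' assume "B \<in> \<I>" "i \<in> ?R \<inter> B" "i' \<in> ?R \<inter> B"
        moreover have "(\<Sum>i\<in>B. x $ i) = real (card (?R \<inter> B))"
          unfolding card[symmetric] by (intro sum.cong refl x')
        ultimately show "i = i'"
          using x by (auto simp: X_set_def card_le_Suc0_iff_eq)
      qed
      ultimately show "\<exists>R T. (x, y, z) = vertex ends R T \<and> indep \<I> R" by blast
    qed
    show "?B \<subseteq> ?A"
      by (auto simp: vertex_def X_set_def card indep_def card_le_Suc0_iff_eq)
  qed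
  then show ?thesis by (simp add: P_poly_def)
qed

lemma inner_vertex:
  assumes "inj ends"
  shows "c \<bullet> vertex ends R T =
    (\<Sum>i\<in>R. fst c $ i) + (\<Sum>j\<in>T. fst (snd c) $ j) + (\<Sum>i\<in>R. \<Sum>j\<in>T. zcoeff ends c i j)"
proof -
  have "(\<Sum>e\<in>UNIV. snd (snd c) $ e * of_bool (fst (ends e) \<in> R \<and> snd (ends e) \<in> T))
      = (\<Sum>e\<in>{e. ends e \<in> R \<times> T}. snd (snd c) $ e)"
    by (intro sum.mono_neutral_cong_right) (auto simp: mem_Times_iff)
  also have "\<dots> = (\<Sum>e\<in>{e. ends e \<in> R \<times> T}. zcoeff ends c (fst (ends e)) (snd (ends e)))"
    using edge_ends[OF assms] by (intro sum.cong) (auto simp: zcoeff_def nbrs_def)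
  also have "\<dots> = (\<Sum>(i, j)\<in>ends ` {e. ends e \<in> R \<times> T}. zcoeff ends c i j)"
    using assms by (subst sum.reindex) (auto intro: inj_on_subset simp: case_prod_beta)
  also have "\<dots> = (\<Sum>(i, j)\<in>R \<times> T. zcoeff ends c i j)"
  proof -
    have "zcoeff ends c i j = 0" if "(i, j) \<in> R \<times> T - ends ` {e. ends e \<in> R \<times> T}" for i j
    proof -
      have False if "(i, j) = ends e" for e
        using that \<open>(i, j) \<in> _\<close> by (metis DiffD1 DiffD2 imageI mem_Collect_eq)
      then show ?thesis by (auto simp: zcoeff_def nbrs_def)
    qed
    then show ?thesis
      by (intro sum.mono_neutral_left) auto
  qed
  finally have "snd (snd c) \<bullet> (\<chi> e. of_bool (fst (ends e) \<in> R \<and> snd (ends e) \<in> T))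
      = (\<Sum>i\<in>R. \<Sum>j\<in>T. zcoeff ends c i j)"
    by (simp add: inner_vec_def sum.cartesian_product)
  moreover have "fst c \<bullet> (\<chi> i. of_bool (i \<in> R)) = (\<Sum>i\<in>R. fst c $ i)"
    unfolding inner_vec_def by (intro sum.mono_neutral_cong_right) auto
  moreover have "fst (snd c) \<bullet> (\<chi> i. of_bool (i \<in> T)) = (\<Sum>i\<in>T. fst (snd c) $ i)"
    unfolding inner_vec_def by (intro sum.mono_neutral_cong_right) auto
  ultimately show ?thesis
    by (simp add: vertex_def inner_prod_def)
qed

section \<open>Switching as complementation of the coordinates in a set \<open>Y\<close>\<close>

lemma sum_sym_diff:
  fixes f :: "'a::finite \<Rightarrow> real"
  shows "(\<Sum>j\<in>sym_diff T Y. f j) = (\<Sum>j\<in>Y. f j) + (\<Sum>j\<in>T. if j \<in> Y then - f j else f j)"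
proof -
  have "(\<Sum>j\<in>sym_diff T Y. f j) = (\<Sum>j\<in>T - Y. f j) + (\<Sum>j\<in>Y - T. f j)"
    by (intro sum.union_disjoint) auto
  moreover have "(\<Sum>j\<in>Y. f j) = (\<Sum>j\<in>Y - T. f j) + (\<Sum>j\<in>T \<inter> Y. f j)"
    by (subst sum.union_disjoint[symmetric]) (auto intro: sum.cong)
  moreover have "(\<Sum>j\<in>T. if j \<in> Y then - f j else f j) = (\<Sum>j\<in>T - Y. f j) - (\<Sum>j\<in>T \<inter> Y. f j)"
    by (simp add: sum.If_cases sum_negf Diff_eq)
  ultimately show ?thesis by simp
qed

text \<open>For \<open>j\<close> in \<open>Y\<close>, switching substitutes \<open>1 - y_j\<close>
  for \<open>y_j\<close> and hence \<open>x_i - z_ij\<close> for \<open>z_ij\<close>; constants move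
  to the right-hand side and \<open>x_i\<close> collects edge coefficients. On vertices this
  complements \<open>T\<close> within \<open>Y\<close>.\<close>

lemma switching_inner_vertex:
  assumes "inj ends"
  shows "fst (switching ends Y (c, d)) \<bullet> vertex ends R T - snd (switching ends Y (c, d))
       = c \<bullet> vertex ends R (sym_diff T Y) - d"
proof -
  obtain cx cy cz where c: "c = (cx, cy, cz)" by (metis prod.collapse)
  let ?c = "fst (switching ends Y (c, d))"
  have z: "zcoeff ends ?c i j = (if j \<in> Y then - zcoeff ends c i j else zcoeff ends c i j)" for i j
    by (auto simp: zcoeff_def switching_def c ends_edge)
  have x: "fst ?c $ i = cx $ i + (\<Sum>j\<in>Y. zcoeff ends c i j)" for i
    by (auto simp: zcoeff_def switching_def c sum.inter_restrict intro!: sum.cong)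
  have y: "fst (snd ?c) $ j = (if j \<in> Y then - cy $ j else cy $ j)" for j
    by (simp add: switching_def c)
  have d: "snd (switching ends Y (c, d)) = d - (\<Sum>j\<in>Y. cy $ j)"
    by (simp add: switching_def c)
  show ?thesis
    unfolding inner_vertex[OF assms] sum_sym_diff x y z d
    by (simp add: sum.distrib c cong: if_cong)
qed

lemma switching_empty [simp]: "switching ends {} ineq = ineq"
  by (auto simp: switching_def split_beta vec_eq_iff prod_eq_iff)

text \<open>The \<open>y\<close>- and \<open>z\<close>-coefficients only change sign, so they vanish
  first; the correction to the \<open>x\<close>-coefficients is then zero too.\<close>

lemma fst_switching_eq_0D:
  assumes "fst (switching ends Y (c, d)) = 0"
  shows "c = 0"
proof -
  obtain cx cy cz where c: "c = (cx, cy, cz)" by (metis prod.collapse)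
  have "cy $ j = 0" "cz $ e = 0" for j e
    using assms by (auto simp: switching_def c vec_eq_iff zero_prod_def split: if_splits)
  with assms show ?thesis
    by (auto simp: switching_def c vec_eq_iff zero_prod_def)
qed

lemma sum_eq_single:
  fixes f :: "'a \<Rightarrow> real"
  assumes "finite A" "a \<in> A" "\<And>x. \<lbrakk>x \<in> A; x \<noteq> a\<rbrakk> \<Longrightarrow> f x = 0"
  shows "sum f A = f a"
  using assms by (subst sum.remove[of A a]) auto

section \<open>The dependency cycle and its adjacencies\<close>

locale dependency_cycle =
  fixes ends :: "'e::finite \<Rightarrow> 'x::finite \<times> 'y::finite"
    and \<I> :: "'x set set"
    and m :: nat
    and I :: "nat \<Rightarrow> 'x set"
    and j :: "nat \<Rightarrow> 'y"
    and S :: "nat \<Rightarrow> 'x set"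
  assumes inj_ends: "inj ends"
    and partition: "partition_on UNIV \<I>"
    and uniform: "subset_uniform ends \<I>"
    and m: "m \<ge> 2"
    and cycle: "simple_chordless_cycle (dep_edges ends \<I>) m I j"
    and S: "\<forall>p\<in>{1..m}. S p \<subseteq> I p \<and> S p \<noteq> {}"
begin

lemma inj_I: "inj_on I {1..m}" and inj_j: "inj_on j {1..m}"
  and dep_edges_cycle: "cycle_edges m I j \<subseteq> dep_edges ends \<I>"
    "dep_edges ends \<I> \<inter> (I ` {1..m} \<times> j ` {1..m}) \<subseteq> cycle_edges m I j"
  using cycle unfolding simple_chordless_cycle_def by blast+

lemma I_in: "p \<in> {1..m} \<Longrightarrow> I p \<in> \<I>"
  using dep_edges_cycle(1) unfolding cycle_edges_def dep_edges_def by blast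

lemma S_I: "\<lbrakk>i \<in> S p; p \<in> {1..m}\<rbrakk> \<Longrightarrow> i \<in> I p"
  using S by blast

lemma block_unique: "\<lbrakk>B \<in> \<I>; B' \<in> \<I>; i \<in> B; i \<in> B'\<rbrakk> \<Longrightarrow> B = B'"
  using partition unfolding partition_on_def disjoint_def by blast

lemma I_unique: "\<lbrakk>i \<in> I p; i \<in> I q; p \<in> {1..m}; q \<in> {1..m}\<rbrakk> \<Longrightarrow> p = q"
  using block_unique[OF I_in[of p] I_in[of q]] inj_onD[OF inj_I, of p q] by blast

lemma j_image: "\<lbrakk>B \<subseteq> {1..m}; p \<in> {1..m}\<rbrakk> \<Longrightarrow> j p \<in> j ` B \<longleftrightarrow> p \<in> B"
  by (rule inj_on_image_mem_iff[OF inj_j])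

text \<open>Uniformity lifts adjacency of one node to its block, and chordlessness leaves only cycle
  edges. The last disjunct is the closing edge.\<close>

lemma adjacent_iff:
  assumes "i \<in> I p" "p \<in> {1..m}" "q \<in> {1..m}"
  shows "j q \<in> nbrs ends i \<longleftrightarrow> p = q \<or> p = Suc q \<or> p = 1 \<and> q = m"
proof -
  have "j q \<in> nbrs ends i \<longleftrightarrow> (I p, j q) \<in> dep_edges ends \<I>"
    using uniform assms(1) I_in[OF assms(2)] unfolding dep_edges_def subset_uniform_def by blast
  also have "\<dots> \<longleftrightarrow> (I p, j q) \<in> cycle_edges m I j"
    using dep_edges_cycle assms(2,3) by blast
  also have "\<dots> \<longleftrightarrow> p = q \<or> p = Suc q \<or> p = 1 \<and> q = m"
  proof
    have inj: "I p = I p' \<longleftrightarrow> p = p'" "j q = j p' \<longleftrightarrow> q = p'" if "p' \<in> {1..m}" for p'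
      using inj_on_eq_iff[OF inj_I] inj_on_eq_iff[OF inj_j] that assms by blast+
    assume "(I p, j q) \<in> cycle_edges m I j"
    then consider p' where "p' \<in> {1..m}" "I p = I p'" "j q = j p'"
      | p' where "p' \<in> {1..<m}" "I p = I (Suc p')" "j q = j p'" | "I p = I 1" "j q = j m"
      unfolding cycle_edges_def by blast
    then show "p = q \<or> p = Suc q \<or> p = 1 \<and> q = m"
    proof cases
      case 1
      then show ?thesis using inj by blast
    next
      case 2
      then show ?thesis using inj(1)[of "Suc p'"] inj(2)[of p'] by simp
    next
      case 3
      then show ?thesis using m inj(1)[of 1] inj(2)[of m] by simp
    qed
  next
    assume "p = q \<or> p = Suc q \<or> p = 1 \<and> q = m"
    with assms show "(I p, j q) \<in> cycle_edges m I j"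
      unfolding cycle_edges_def by fastforce
  qed
  finally show ?thesis .
qed

section \<open>The cycle inequality on vertices: validity and tightness\<close>

text \<open>Independence leaves at most one nonzero term in each sum over \<open>S p\<close>, so the
  sum collapses to \<open>s p\<close> times a factor in \<open>t\<close>.\<close>

lemma inner_cycle_ineq:
  fixes R :: "'x set" and T :: "'y set"
  defines "s \<equiv> \<lambda>p. of_bool (R \<inter> S p \<noteq> {}) :: real" and "t \<equiv> \<lambda>p. of_bool (j p \<in> T) :: real"
  assumes "indep \<I> R"
  shows "fst (cycle_ineq ends m j S) \<bullet> vertex ends R T =
    s 1 * (t m - t 1) + (\<Sum>p = 2..m. s p * (t (p - 1) + t p - 1) - t p)"
proof -
  have S_sum: "(\<Sum>i\<in>S p. of_bool (i \<in> R) * k) = s p * k" if "p \<in> {1..m}" for p and k :: real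
  proof -
    have "(\<Sum>i\<in>S p. of_bool (i \<in> R) * k) = (\<Sum>i\<in>R \<inter> S p. k)"
      by (intro sum.mono_neutral_cong_right) auto
    moreover have "card (R \<inter> S p) \<le> 1"
      using assms(3) S that I_in[OF that] by (fastforce simp: card_le_Suc0_iff_eq indep_def)
    then have "real (card (R \<inter> S p)) = s p"
      by (cases "R \<inter> S p = {}") (auto simp: s_def le_Suc_eq)
    ultimately show ?thesis by simp
  qed
  let ?z = "\<lambda>i q. of_bool (fst (ends (edge ends i (j q))) \<in> R \<and> snd (ends (edge ends i (j q))) \<in> T)"
  \<comment> \<open>The coordinate at \<open>edge ends i (j q)\<close> is meaningful only for a
    genuine edge, hence the adjacency condition.\<close>
  have z: "?z i q = of_bool (i \<in> R) * t q"
    if "i \<in> S p" "p \<in> {1..m}" "q \<in> {1..m}" "p = q \<or> p = Suc q \<or> p = 1 \<and> q = m" for i p q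
    using that adjacent_iff[OF S_I] by (simp add: ends_edge t_def of_bool_conj)
  have z1: "- ?z i 1 + ?z i m = of_bool (i \<in> R) * (t m - t 1)" if "i \<in> S 1" for i
    using that m z[of i 1] by (simp add: algebra_simps)
  have z2: "- of_bool (i \<in> R) + ?z i (p - 1) + ?z i p = of_bool (i \<in> R) * (t (p - 1) + t p - 1)"
    if "i \<in> S p" "p \<in> {2..m}" for i p
  proof -
    have "p \<in> {1..m}" "p - 1 \<in> {1..m}" "p = Suc (p - 1)"
      using that by auto
    then have "?z i p = of_bool (i \<in> R) * t p" "?z i (p - 1) = of_bool (i \<in> R) * t (p - 1)"
      using z that(1) by blast+
    then show ?thesis by (simp only: algebra_simps)
  qed
  have "fst (cycle_ineq ends m j S) \<bullet> vertex ends R T =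
      (\<Sum>i\<in>S 1. of_bool (i \<in> R) * (t m - t 1)) +
      (\<Sum>p = 2..m. - t p + (\<Sum>i\<in>S p. of_bool (i \<in> R) * (t (p - 1) + t p - 1)))"
    unfolding vertex_def cycle_ineq_inner vec_lambda_beta
    by (intro arg_cong2[of _ _ _ _ "(+)"] sum.cong refl z1 z2) (simp_all add: t_def)
  also have "\<dots> = s 1 * (t m - t 1) + (\<Sum>p = 2..m. s p * (t (p - 1) + t p - 1) - t p)"
  proof -
    have "(\<Sum>p = 2..m. - t p + (\<Sum>i\<in>S p. of_bool (i \<in> R) * (t (p - 1) + t p - 1)))
        = (\<Sum>p = 2..m. s p * (t (p - 1) + t p - 1) - t p)"
      by (intro sum.cong refl, subst S_sum) auto
    moreover have "1 \<in> {1..m}"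
      using m by simp
    ultimately show ?thesis
      by (simp only: S_sum)
  qed
  finally show ?thesis .
qed

text \<open>Validity splits on \<open>s 1\<close>: if \<open>s 1\<close> fails, each summand for \<open>p \<ge> 2\<close> has to attain its bound
  \<open>0\<close>, and otherwise its bound \<open>t (p - 1) - t p\<close>. The two branches say exactly this.\<close>

definition tight_pattern :: "(nat \<Rightarrow> bool) \<Rightarrow> (nat \<Rightarrow> bool) \<Rightarrow> bool" where
  "tight_pattern s t \<longleftrightarrow>
     (if s 1 then \<forall>p\<in>{2..m}. if s p then t p else \<not> t (p - 1)
      else \<forall>p\<in>{2..m}. if s p then t (p - 1) else \<not> t p)"

definition tight :: "'x set \<Rightarrow> 'y set \<Rightarrow> bool" where
  "tight R T \<longleftrightarrow> indep \<I> R \<and> tight_pattern (\<lambda>p. R \<inter> S p \<noteq> {}) (\<lambda>p. j p \<in> T)"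

lemma tight_pattern_cong:
  assumes "\<And>p. p \<in> {1..m} \<Longrightarrow> s p = s' p" "\<And>p. p \<in> {1..m} \<Longrightarrow> t p = t' p"
  shows "tight_pattern s t = tight_pattern s' t'"
proof -
  have 1: "s 1 = s' 1"
    using m by (intro assms) auto
  have 2: "s p = s' p" "t p = t' p" "t (p - 1) = t' (p - 1)" if "p \<in> {2..m}" for p
    using that by (auto intro!: assms simp del: One_nat_def)
  show ?thesis
    unfolding tight_pattern_def 1 by (simp only: 2 cong: ball_cong)
qed

lemma telescope: "(\<Sum>p = 2..m. t (p - 1) - t p) = t 1 - (t m :: real)"
proof -
  have "(\<Sum>p = 2..m. t (p - 1) - t p) = (\<Sum>p = 1..m - 1. t p - t (Suc p))"
    using m by (intro sum.reindex_bij_witness[of _ Suc "\<lambda>p. p - 1"]) auto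
  also have "\<dots> = t 1 - t m"
    using m sum_Suc_diff'[of 1 m "\<lambda>p. - t p"]
    by (simp add: sum_negf atLeastLessThanSuc_atLeastAtMost[symmetric])
  finally show ?thesis .
qed

lemma cycle_ineq_le:
  assumes "indep \<I> R"
  shows "fst (cycle_ineq ends m j S) \<bullet> vertex ends R T \<le> 0"
proof -
  let ?s = "\<lambda>p. of_bool (R \<inter> S p \<noteq> {}) :: real" and ?t = "\<lambda>p. of_bool (j p \<in> T) :: real"
  let ?f = "\<lambda>p. ?s p * (?t (p - 1) + ?t p - 1) - ?t p"
  have "sum ?f {2..m} \<le> 0"
    by (intro sum_nonpos) auto
  moreover have "sum ?f {2..m} \<le> ?t 1 - ?t m"
    unfolding telescope[of ?t, symmetric] by (intro sum_mono) auto
  moreover have "?s 1 * (?t m - ?t 1) + x \<le> 0" if "x \<le> 0" "x \<le> ?t 1 - ?t m" for x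
    using that by (cases "R \<inter> S 1 = {}") auto
  ultimately show ?thesis
    unfolding inner_cycle_ineq[OF assms] by (simp only:)
qed

lemma cycle_ineq_tight:
  assumes "tight R T"
  shows "fst (cycle_ineq ends m j S) \<bullet> vertex ends R T = 0"
proof -
  let ?s = "\<lambda>p. of_bool (R \<inter> S p \<noteq> {}) :: real" and ?t = "\<lambda>p. of_bool (j p \<in> T) :: real"
  let ?f = "\<lambda>p. ?s p * (?t (p - 1) + ?t p - 1) - ?t p"
  have indep: "indep \<I> R"
    using assms by (simp add: tight_def)
  show ?thesis
  proof (cases "R \<inter> S 1 = {}")
    case True
    then have "sum ?f {2..m} = 0"
      using assms by (intro sum.neutral) (auto simp: tight_def tight_pattern_def split: if_splits)
    with True show ?thesis
      by (simp add: inner_cycle_ineq[OF indep])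
  next
    case False
    then have "sum ?f {2..m} = (\<Sum>p = 2..m. ?t (p - 1) - ?t p)"
      using assms by (intro sum.cong) (auto simp: tight_def tight_pattern_def split: if_splits)
    moreover have "?s 1 = 1"
      using False by simp
    moreover have "1 * (a - b) + (b - a) = 0" for a b :: real
      by simp
    ultimately show ?thesis
      unfolding inner_cycle_ineq[OF indep] by (simp only: telescope[of ?t])
  qed
qed

text \<open>A vertex off the face: with \<open>R\<close> empty only the terms \<open>- t p\<close>
  remain, and injectivity of \<open>j\<close> leaves just \<open>p = 2\<close>.\<close>

lemma cycle_ineq_strict: "fst (cycle_ineq ends m j S) \<bullet> vertex ends {} {j 2} = - 1"
proof -
  have "(\<Sum>p = 2..m. - of_bool (j p = j 2)) = (- 1 :: real)"
    using m inj_j by (subst sum_eq_single[where a = 2]) (auto simp: inj_on_eq_iff)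
  then show ?thesis
    by (simp add: inner_cycle_ineq)
qed

section \<open>Transversals of the sets \<open>S p\<close> and two families of tight
  vertices\<close>

definition selection :: "(nat \<Rightarrow> 'x) \<Rightarrow> bool" where
  "selection r \<longleftrightarrow> (\<forall>p\<in>{1..m}. r p \<in> S p)"

text \<open>Routing a transversal through a prescribed node turns facts about \<open>r p\<close>
  into facts about every node of \<open>S p\<close>.\<close>

lemma selectionE:
  assumes "i \<in> S p"
  obtains r where "selection r" "r p = i"
proof -
  obtain r where r: "\<forall>p\<in>{1..m}. r p \<in> S p"
    using bchoice[of "{1..m}" "\<lambda>p i. i \<in> S p"] S by blast
  show thesis
    using r assms by (intro that[of "r(p := i)"]) (auto simp: selection_def)
qed

lemma image_Int_I:
  assumes "selection r" "A \<subseteq> {1..m}" "p \<in> {1..m}"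
  shows "r ` A \<inter> I p = {} \<longleftrightarrow> p \<notin> A"
proof -
  have "r q \<in> I q" if "q \<in> {1..m}" for q
    using that assms(1) S_I by (auto simp: selection_def)
  then have "q = p" if "q \<in> A" "r q \<in> I p" for q
    using that assms(2,3) I_unique[of "r q" q p] by blast
  moreover have "r p \<in> I p"
    using assms(1,3) S_I by (auto simp: selection_def)
  ultimately show ?thesis
    by (auto simp: disjoint_iff)
qed

lemma image_Int_S:
  assumes "selection r" "A \<subseteq> {1..m}" "p \<in> {1..m}"
  shows "r ` A \<inter> S p = {} \<longleftrightarrow> p \<notin> A"
proof -
  have "r ` A \<inter> S p = {}" if "p \<notin> A"
    using that image_Int_I[OF assms] assms(3) S_I[of _ p] by (auto simp: disjoint_iff)
  then show ?thesis
    using assms(1,3) by (auto simp: selection_def)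
qed

lemma inj_on_selection: "selection r \<Longrightarrow> inj_on r {1..m}"
proof (rule inj_onI)
  fix p q assume "selection r" and pq: "p \<in> {1..m}" "q \<in> {1..m}" "r p = r q"
  then have "r p \<in> S p" "r q \<in> S q"
    unfolding selection_def by blast+
  then have "r p \<in> I p" "r q \<in> I q"
    using pq S_I by blast+
  with pq show "p = q" using I_unique[of "r p" p q] by simp
qed

lemma indep_image:
  assumes "selection r" "A \<subseteq> {1..m}"
  shows "indep \<I> (r ` A)"
  unfolding indep_def
proof clarify
  fix B p q assume "B \<in> \<I>" and A: "p \<in> A" "q \<in> A" and B: "r p \<in> B" "r q \<in> B"
  moreover have pq: "p \<in> {1..m}" "q \<in> {1..m}"
    using A assms(2) by blast+
  moreover from this have "r p \<in> I p" "r q \<in> I q"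
    using assms(1) S_I unfolding selection_def by blast+
  ultimately have "r p \<in> I q"
    using block_unique[OF _ I_in[OF pq(2)], of B "r q"] by blast
  then have "p = q"
    using I_unique[OF \<open>r p \<in> I p\<close> _ pq] by blast
  then show "r p = r q" by simp
qed

lemma tight_image:
  assumes "selection r" "A \<subseteq> {1..m}" "B \<subseteq> {1..m}"
  shows "tight (r ` A) (j ` B) \<longleftrightarrow> tight_pattern (\<lambda>p. p \<in> A) (\<lambda>p. p \<in> B)"
  using tight_pattern_cong[of "\<lambda>p. r ` A \<inter> S p \<noteq> {}" "\<lambda>p. p \<in> A" "\<lambda>p. j p \<in> j ` B" "\<lambda>p. p \<in> B"]
  by (simp only: tight_def indep_image image_Int_S[OF assms(1,2)] j_image assms simp_thms)

text \<open>Index 1 is absent, so \<open>p \<le> q\<close> needs \<open>p - 1 \<le> t\<close> and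
  \<open>p > q\<close> needs \<open>p > t\<close>. Either of \<open>t = q - 1\<close> and
  \<open>t = q\<close> works; this slack yields tight pairs differing in one element.\<close>

lemma tight_low:
  assumes "selection r" "1 \<le> q" "q \<le> m" "t \<le> q" "q \<le> Suc t"
  shows "tight (r ` {2..q}) (j ` {1..t})"
  using assms by (subst tight_image) (auto simp: tight_pattern_def)

text \<open>Index 1 is present, so \<open>p > q\<close> needs \<open>p \<ge> t\<close> and
  \<open>2 \<le> p \<le> q\<close> needs \<open>p - 1 < t\<close>. Again two values of
  \<open>t\<close> fit each \<open>q\<close>.\<close>

lemma tight_high:
  assumes "selection r" "1 \<le> q" "q \<le> m" "q \<le> t" "t \<le> Suc q"
  shows "tight (r ` insert 1 {q<..m}) (j ` {t..m})"
  using assms by (subst tight_image) (auto simp: tight_pattern_def)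

lemma tight_insert_left:
  assumes "tight R T" "i \<notin> (\<Union>p\<in>{1..m}. S p)" "indep \<I> (insert i R)"
  shows "tight (insert i R) T"
  using assms tight_pattern_cong[of "\<lambda>p. insert i R \<inter> S p \<noteq> {}" "\<lambda>p. R \<inter> S p \<noteq> {}" "\<lambda>p. j p \<in> T"]
  by (simp add: tight_def)

lemma tight_insert_right:
  assumes "tight R T" "k \<notin> j ` {1..m}"
  shows "tight R (insert k T)"
proof -
  have "j p \<in> insert k T \<longleftrightarrow> j p \<in> T" if "p \<in> {1..m}" for p
    using assms(2) that by blast
  then have "tight_pattern (\<lambda>p. R \<inter> S p \<noteq> {}) (\<lambda>p. j p \<in> insert k T)
      = tight_pattern (\<lambda>p. R \<inter> S p \<noteq> {}) (\<lambda>p. j p \<in> T)"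
    by (intro tight_pattern_cong refl)
  with assms(1) show ?thesis
    unfolding tight_def by (simp only:)
qed

lemma tight_empty: "tight {} {}"
  by (simp add: tight_def tight_pattern_def)

text \<open>The slack of the low family read at fixed \<open>R\<close>: \<open>t = q - 1\<close>
  against \<open>t = q\<close>.\<close>

lemma tight_low_y:
  assumes "selection r" "q \<in> {1..m}"
  shows "tight (r ` {2..q}) (j ` {1..q - 1})"
    and "tight (r ` {2..q}) (insert (j q) (j ` {1..q - 1}))"
    and "j q \<notin> j ` {1..q - 1}"
proof -
  have "{1..q} = insert q {1..q - 1}"
    using assms by auto
  then have "insert (j q) (j ` {1..q - 1}) = j ` {1..q}"
    by (metis image_insert)
  moreover have "tight (r ` {2..q}) (j ` {1..q})"
    using assms by (intro tight_low) auto
  ultimately show "tight (r ` {2..q}) (insert (j q) (j ` {1..q - 1}))"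
    by (simp only:)
  show "tight (r ` {2..q}) (j ` {1..q - 1})"
    using assms by (intro tight_low) auto
  show "j q \<notin> j ` {1..q - 1}"
    using assms by (subst j_image) auto
qed

lemma tight_high_y:
  assumes "selection r" "q \<in> {1..m}"
  shows "tight (r ` insert 1 {q<..m}) (j ` {Suc q..m})"
    and "tight (r ` insert 1 {q<..m}) (insert (j q) (j ` {Suc q..m}))"
    and "j q \<notin> j ` {Suc q..m}"
proof -
  have "{q..m} = insert q {Suc q..m}"
    using assms by auto
  then have "insert (j q) (j ` {Suc q..m}) = j ` {q..m}"
    by (metis image_insert)
  moreover have "tight (r ` insert 1 {q<..m}) (j ` {q..m})"
    using assms by (intro tight_high) auto
  ultimately show "tight (r ` insert 1 {q<..m}) (insert (j q) (j ` {Suc q..m}))"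
    by (simp only:)
  show "tight (r ` insert 1 {q<..m}) (j ` {Suc q..m})"
    using assms by (intro tight_high) auto
  show "j q \<notin> j ` {Suc q..m}"
    using assms by (subst j_image) auto
qed

lemma tight_low_x:
  assumes "selection r" "p \<in> {2..m}"
  shows "tight (r ` {2..p - 1}) (j ` {1..p - 1})"
    and "tight (insert (r p) (r ` {2..p - 1})) (j ` {1..p - 1})"
    and "r p \<notin> r ` {2..p - 1}"
proof -
  have "{2..p} = insert p {2..p - 1}"
    using assms by auto
  then have "insert (r p) (r ` {2..p - 1}) = r ` {2..p}"
    by (metis image_insert)
  moreover have "tight (r ` {2..p}) (j ` {1..p - 1})"
    using assms by (intro tight_low) auto
  ultimately show "tight (insert (r p) (r ` {2..p - 1})) (j ` {1..p - 1})"
    by (simp only:)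
  show "tight (r ` {2..p - 1}) (j ` {1..p - 1})"
    using assms by (intro tight_low) auto
  show "r p \<notin> r ` {2..p - 1}"
    using assms by (subst inj_on_image_mem_iff[OF inj_on_selection[OF assms(1)]]) auto
qed

text \<open>The high family at \<open>t = p\<close>, compared for \<open>q = p\<close> and
  \<open>q = p - 1\<close>; \<open>p \<ge> 2\<close> keeps the latter admissible.\<close>

lemma tight_high_x:
  assumes "selection r" "p \<in> {2..m}"
  shows "tight (r ` insert 1 {p<..m}) (j ` {p..m})"
    and "tight (insert (r p) (r ` insert 1 {p<..m})) (j ` {p..m})"
    and "r p \<notin> r ` insert 1 {p<..m}"
proof -
  have "insert 1 {p - 1<..m} = insert p (insert 1 {p<..m})"
    using assms by auto
  then have "insert (r p) (r ` insert 1 {p<..m}) = r ` insert 1 {p - 1<..m}"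
    by (metis image_insert)
  moreover have "tight (r ` insert 1 {p - 1<..m}) (j ` {p..m})"
    using assms by (intro tight_high) auto
  ultimately show "tight (insert (r p) (r ` insert 1 {p<..m})) (j ` {p..m})"
    by (simp only:)
  show "tight (r ` insert 1 {p<..m}) (j ` {p..m})"
    using assms by (intro tight_high) auto
  show "r p \<notin> r ` insert 1 {p<..m}"
    using assms by (subst inj_on_image_mem_iff[OF inj_on_selection[OF assms(1)]]) auto
qed

end

section \<open>Vanishing of a normalized form that is constant on tight vertices\<close>

text \<open>The node \<open>j 2\<close> suits the normalization because its
  \<open>y\<close>-coefficient in the cycle inequality is -1, and it starts the chain in
  \<open>y_zero\<close>.\<close>

locale tight_form = dependency_cycle ends \<I> m I j S
  for ends :: "'e::finite \<Rightarrow> 'x::finite \<times> 'y::finite" and \<I> m I j S +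
  fixes c :: "('x, 'y, 'e) vec3" and d :: real
  assumes tight_form: "tight R T \<Longrightarrow> c \<bullet> vertex ends R T = d"
    and normalized: "fst (snd c) $ j 2 = 0"
begin

abbreviation w :: "'x \<Rightarrow> 'y \<Rightarrow> real" where "w \<equiv> zcoeff ends c"

lemma y_difference:
  assumes "tight R T" "tight R (insert k T)" "k \<notin> T"
  shows "fst (snd c) $ k + (\<Sum>i\<in>R. w i k) = 0"
proof -
  have "c \<bullet> vertex ends R (insert k T) = c \<bullet> vertex ends R T"
    using tight_form assms by simp
  then show ?thesis
    using assms(3) by (simp add: inner_vertex inj_ends sum.distrib)
qed

lemma x_difference:
  assumes "tight R T" "tight (insert i R) T" "i \<notin> R"
  shows "fst c $ i + (\<Sum>k\<in>T. w i k) = 0"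
proof -
  have "c \<bullet> vertex ends (insert i R) T = c \<bullet> vertex ends R T"
    using tight_form assms by simp
  then show ?thesis
    using assms(3) by (simp add: inner_vertex inj_ends)
qed

text \<open>A mixed second difference over a square of four tight vertices cancels everything but
  the bilinear term.\<close>

lemma xy_difference:
  assumes "tight R T" "tight R (insert k T)" "tight (insert i R) T" "tight (insert i R) (insert k T)"
    and "i \<notin> R" "k \<notin> T"
  shows "w i k = 0"
  using y_difference[OF assms(1,2,6)] y_difference[OF assms(3,4,6)] assms(5) by simp

lemma selection_sum:
  assumes "selection r" "A \<subseteq> {1..m}"
  shows "(\<Sum>i\<in>r ` A. f i) = (\<Sum>p\<in>A. f (r p))"
  by (rule sum.reindex_cong[OF inj_on_subset[OF inj_on_selection[OF assms(1)] assms(2)]]) auto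

lemma w_nonadjacent:
  assumes "i \<in> S p" "p \<in> {1..m}" "q \<in> {1..m}" "p \<noteq> q" "p \<noteq> Suc q" "\<not> (p = 1 \<and> q = m)"
  shows "w i (j q) = 0"
proof -
  have "j q \<notin> nbrs ends i"
    using adjacent_iff[OF S_I[OF assms(1,2)] assms(2,3)] assms(4-6) by blast
  then show ?thesis
    by (simp add: zcoeff_def)
qed

lemma y_low:
  assumes "selection r" "q \<in> {1..m}"
  shows "fst (snd c) $ j q + (\<Sum>p\<in>{2..q}. w (r p) (j q)) = 0"
  using y_difference[OF tight_low_y[OF assms]] assms by (subst (asm) selection_sum) auto

lemma y_high:
  assumes "selection r" "q \<in> {1..m}"
  shows "fst (snd c) $ j q + (\<Sum>p\<in>insert 1 {q<..m}. w (r p) (j q)) = 0"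
  using y_difference[OF tight_high_y[OF assms]] assms by (subst (asm) selection_sum) auto

text \<open>Among \<open>j 1, ..., j (p - 1)\<close> only the last is adjacent to
  \<open>S p\<close>. With \<open>x_high\<close>, this equates the coefficients of the two cycle
  edges at \<open>i\<close>.\<close>

lemma x_low:
  assumes "i \<in> S p" "p \<in> {2..m}"
  shows "fst c $ i = - w i (j (p - 1))"
proof -
  obtain r where r: "selection r" "r p = i"
    using selectionE[OF assms(1)] .
  have "fst c $ i + (\<Sum>k\<in>j ` {1..p - 1}. w i k) = 0"
    using x_difference[OF tight_low_x[OF r(1) assms(2)]] r(2) by (simp only:)
  also have "(\<Sum>k\<in>j ` {1..p - 1}. w i k) = (\<Sum>q\<in>{1..p - 1}. w i (j q))"
    using assms(2) by (intro sum.reindex_cong[OF inj_on_subset[OF inj_j]]) auto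
  also have "\<dots> = w i (j (p - 1))"
    using assms by (intro sum_eq_single w_nonadjacent[of i p]) auto
  finally show ?thesis by simp
qed

lemma x_high:
  assumes "i \<in> S p" "p \<in> {2..m}"
  shows "fst c $ i = - w i (j p)"
proof -
  obtain r where r: "selection r" "r p = i"
    using selectionE[OF assms(1)] .
  have "fst c $ i + (\<Sum>k\<in>j ` {p..m}. w i k) = 0"
    using x_difference[OF tight_high_x[OF r(1) assms(2)]] r(2) by (simp only:)
  also have "(\<Sum>k\<in>j ` {p..m}. w i k) = (\<Sum>q\<in>{p..m}. w i (j q))"
    using assms(2) by (intro sum.reindex_cong[OF inj_on_subset[OF inj_j]]) auto
  also have "\<dots> = w i (j p)"
    using assms by (intro sum_eq_single w_nonadjacent[of i p]) auto
  finally show ?thesis by simp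
qed

lemma w_same:
  assumes "i \<in> S q" "q \<in> {2..m}"
  shows "w i (j q) = - fst (snd c) $ j q"
proof -
  obtain r where r: "selection r" "r q = i"
    using selectionE[OF assms(1)] .
  have "(\<Sum>p\<in>{2..q}. w (r p) (j q)) = w (r q) (j q)"
    using assms r by (intro sum_eq_single w_nonadjacent) (auto simp: selection_def)
  with y_low[OF r(1), of q] assms r(2) show ?thesis by simp
qed

text \<open>In the high family only \<open>r (Suc q)\<close> is adjacent to \<open>j q\<close>; the
  bounds exclude \<open>q = 1\<close> and \<open>q = m\<close>, where \<open>r 1\<close> is adjacent
  as well.\<close>

lemma w_next:
  assumes "i \<in> S (Suc q)" "2 \<le> q" "q < m"
  shows "w i (j q) = - fst (snd c) $ j q"
proof -
  obtain r where r: "selection r" "r (Suc q) = i"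
    using selectionE[OF assms(1)] .
  have "(\<Sum>p\<in>insert 1 {q<..m}. w (r p) (j q)) = w (r (Suc q)) (j q)"
  proof (intro sum_eq_single)
    fix p assume p: "p \<in> insert 1 {q<..m}" "p \<noteq> Suc q"
    then have "p \<in> {1..m}" "r p \<in> S p"
      using assms r(1) by (auto simp: selection_def)
    with p assms show "w (r p) (j q) = 0"
      by (intro w_nonadjacent) auto
  qed (use assms in auto)
  with y_high[OF r(1), of q] assms r(2) show ?thesis by simp
qed

lemma w_first_last:
  assumes "i \<in> S 1"
  shows "w i (j m) = - fst (snd c) $ j m"
proof -
  obtain r where "selection r" "r 1 = i"
    using selectionE[OF assms] .
  with y_high[of r m] m show ?thesis by simp
qed

lemma y_zero: "fst (snd c) $ k = 0"
proof (cases "k \<in> j ` {2..m}")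
  case True
  then obtain q where q: "q \<in> {2..m}" "k = j q" by auto
  have "fst (snd c) $ j q = 0" if "2 \<le> q" "q \<le> m" for q
    using that
  proof (induction q rule: dec_induct)
    case base
    show ?case by (rule normalized)
  next
    case (step q)
    then obtain i where "i \<in> S (Suc q)"
      using S by fastforce
    \<comment> \<open>A node of \<open>S (Suc q)\<close> carries the value from \<open>j q\<close>
      to \<open>j (Suc q)\<close>, as its two edge coefficients agree.\<close>
    then have "w i (j q) = w i (j (Suc q))" "w i (j q) = - fst (snd c) $ j q"
      "w i (j (Suc q)) = - fst (snd c) $ j (Suc q)"
      using x_low[of i "Suc q"] x_high[of i "Suc q"] w_next[of i q] w_same[of i "Suc q"] step by auto
    with step show ?case by simp
  qed
  with q show ?thesis by simp
next
  case False
  \<comment> \<open>This covers \<open>j 1\<close> as well as the nodes off the cycle: with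
    \<open>R\<close> empty only \<open>j 2, ..., j m\<close> are forbidden in
    \<open>T\<close>.\<close>
  then have "tight {} {k}"
    by (auto simp: tight_def tight_pattern_def)
  with tight_empty show ?thesis
    using y_difference[of "{}" "{}" k] by simp
qed

lemma w_cycle_zero:
  assumes i: "i \<in> S p" "p \<in> {1..m}" and q: "q \<in> {1..m}"
  shows "w i (j q) = 0"
proof -
  have w1: "w i (j 1) = 0" if "i \<in> S 2" for i
    using x_low[OF that] x_high[OF that] w_same[OF that] m y_zero by simp
  consider "p = q" "q \<ge> 2" | "p = q" "q = 1" | "p = Suc q" "q \<ge> 2" | "p = 2" "q = 1"
    | "p = 1" "q = m" | "p \<noteq> q" "p \<noteq> Suc q" "\<not> (p = 1 \<and> q = m)"
    using q by fastforce
  then show ?thesis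
  proof cases
    case 1
    with i q show ?thesis using w_same[of i q] y_zero by simp
  next
    case 3
    with i q show ?thesis using w_next[of i q] y_zero by simp
  next
    case 4
    with i show ?thesis using w1 by simp
  next
    case 5
    with i show ?thesis using w_first_last[of i] y_zero by simp
  next
    case 6
    with i q show ?thesis by (intro w_nonadjacent)
  next
    case 2
    \<comment> \<open>At \<open>j 1\<close> the high family meets two neighbours, \<open>r 1\<close>
      and \<open>r 2\<close>; the coefficient of the second is zero by \<open>w1\<close>.\<close>
    obtain r where r: "selection r" "r 1 = i"
      using selectionE[of i 1] i 2 by blast
    have "(\<Sum>p\<in>{1<..m}. w (r p) (j 1)) = w (r 2) (j 1)"
      using r(1) m by (intro sum_eq_single w_nonadjacent) (auto simp: selection_def)
    moreover have "r 2 \<in> S 2"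
      using r(1) m by (auto simp: selection_def)
    ultimately show ?thesis
      using y_high[OF r(1), of 1] m w1[of "r 2"] y_zero r(2) 2 by simp
  qed
qed

text \<open>Such an \<open>i\<close> does not affect the pattern, so it may join a tight pair
  differing in \<open>k\<close> whenever independence survives. For \<open>k = j q\<close>, the low
  pair serves unless \<open>i\<close> lies in one of \<open>I 2, ..., I q\<close>; in
  \<open>I q\<close> the high pair serves, and in an earlier one \<open>j q\<close> is not adjacent
  to \<open>i\<close>.\<close>

lemma w_zero_unselected:
  assumes i: "i \<notin> (\<Union>p\<in>{1..m}. S p)"
  shows "w i k = 0"
proof -
  have extend: "w i k = 0"
    if "tight R T" "tight R (insert k T)" "k \<notin> T" "indep \<I> (insert i R)" "i \<notin> R" for R T
    using that i by (intro xy_difference[of R T k i] tight_insert_left) auto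
  show ?thesis
  proof (cases "k \<in> j ` {1..m}")
    case False
    then show ?thesis
      by (intro extend[of "{}" "{}"] tight_insert_right tight_empty) (auto simp: indep_insert)
  next
    case True
    then obtain q where q: "q \<in> {1..m}" "k = j q" by auto
    obtain r where r: "selection r"
      using S q(1) selectionE by blast
    have indep: "indep \<I> (insert i (r ` A))" and notin: "i \<notin> r ` A"
      if A: "A \<subseteq> {1..m}" "\<And>p. p \<in> A \<Longrightarrow> i \<notin> I p" for A
    proof -
      have rI: "r p \<in> I p" "I p \<in> \<I>" if "p \<in> A" for p
        using that A(1) r S_I I_in unfolding selection_def by blast+
      have "r ` A \<inter> B = {}" if "B \<in> \<I>" "i \<in> B" for B
      proof -
        have "r p \<notin> B" if "p \<in> A" for p
          using block_unique[of B "I p" "r p"] \<open>B \<in> \<I>\<close> \<open>i \<in> B\<close> rI[OF that] A(2)[OF that] by auto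
        then show ?thesis by blast
      qed
      then show "indep \<I> (insert i (r ` A))"
        using indep_image[OF r A(1)] by (auto simp: indep_insert)
      show "i \<notin> r ` A"
        using rI(1) A(2) by blast
    qed
    show ?thesis
    proof (cases "\<exists>p\<in>{2..q}. i \<in> I p")
      case False
      with q(1) show ?thesis
        unfolding q(2) by (intro extend[unfolded q(2), OF tight_low_y[OF r q(1)]] indep notin) auto
    next
      case True
      then obtain p where p: "p \<in> {2..q}" "i \<in> I p" by blast
      show ?thesis
      proof (cases "p = q")
        case True
        have "i \<notin> I p'" if "p' \<in> insert 1 {q<..m}" for p'
          using that p True q(1) I_unique[of i p' p] by auto
        with q(1) show ?thesis
          unfolding q(2) by (intro extend[unfolded q(2), OF tight_high_y[OF r q(1)]] indep notin) auto
      next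
        case False
        then have "j q \<notin> nbrs ends i"
          using p q(1) by (subst adjacent_iff[of i p]) auto
        then show ?thesis
          by (simp add: zcoeff_def q(2))
      qed
    qed
  qed
qed

text \<open>Here \<open>k\<close> does not affect the pattern, so it may join both members of a
  tight pair differing in \<open>i\<close>.\<close>

lemma w_zero_off_cycle:
  assumes "i \<in> S p" "p \<in> {1..m}" and k: "k \<notin> j ` {1..m}"
  shows "w i k = 0"
proof -
  obtain r where r: "selection r" "r p = i"
    using selectionE[OF assms(1)] .
  have extend: "w i k = 0"
    if "tight R (j ` B)" "tight (insert i R) (j ` B)" "i \<notin> R" "B \<subseteq> {1..m}" for R B
    using that k by (intro xy_difference[of R "j ` B"] tight_insert_right) auto
  show ?thesis
  proof (cases "p = 1")
    case True
    have "tight (r ` {1}) (j ` {})"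
      using r(1) m by (subst tight_image) (auto simp: tight_pattern_def)
    with tight_empty r(2) True show ?thesis
      by (intro extend[of "{}" "{}"]) auto
  next
    case False
    with assms(2) have p: "p \<in> {2..m}" by auto
    then show ?thesis
      by (intro extend[OF tight_low_x[OF r(1) p, unfolded r(2)]]) auto
  qed
qed

lemma w_zero: "w i k = 0"
proof (cases "i \<in> (\<Union>p\<in>{1..m}. S p)")
  case True
  then obtain p where p: "i \<in> S p" "p \<in> {1..m}" by blast
  show ?thesis
  proof (cases "k \<in> j ` {1..m}")
    case True
    with w_cycle_zero[OF p] show ?thesis by blast
  qed (rule w_zero_off_cycle[OF p])
qed (rule w_zero_unselected)

lemma x_zero: "fst c $ i = 0"
proof (cases "i \<in> (\<Union>p\<in>{2..m}. S p)")
  case True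
  then show ?thesis
    using x_low w_zero by auto
next
  case False
  \<comment> \<open>With \<open>T\<close> empty, the pattern only forbids meeting
    \<open>S 2, ..., S m\<close>, whether or not \<open>i\<close> is in \<open>S 1\<close>.\<close>
  then have "tight {i} {}"
    using m by (auto simp: tight_def tight_pattern_def indep_insert)
  then show ?thesis
    using x_difference[OF tight_empty] by simp
qed

lemma coefficients_zero: "c = 0"
proof -
  have "snd (snd c) $ e = 0" for e
    using w_zero[of "fst (ends e)" "snd (ends e)"] edge_ends[OF inj_ends, of e]
    by (auto simp: zcoeff_def nbrs_def)
  then show ?thesis
    using x_zero y_zero by (simp add: prod_eq_iff vec_eq_iff)
qed

end

section \<open>The facet property for all switchings\<close>

context dependency_cycle
begin

lemma switching_defines_facet:
  "defines_facet (switching ends Y (cycle_ineq ends m j S)) (P_poly ends \<I>)"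
proof -
  let ?a = "fst (cycle_ineq ends m j S)"
  let ?V = "{vertex ends R T |R T. indep \<I> R}"
  obtain a b where ab: "switching ends Y (cycle_ineq ends m j S) = (a, b)"
    by fastforce
  have ineq: "cycle_ineq ends m j S = (?a, 0)"
    by (simp add: cycle_ineq_def)
  have switched: "a \<bullet> vertex ends R T - b = ?a \<bullet> vertex ends R (sym_diff T Y)" for R T
    using switching_inner_vertex[OF inj_ends, of Y ?a 0 R T] ab ineq by simp
  have sym_diff: "sym_diff (sym_diff T Y) Y = T" for T
    by blast
  have "defines_facet (a, b) (convex hull ?V)"
  proof (rule defines_facet_convex_hullI[where u = "(0, axis (j 2) 1, 0)"])
    show "a \<bullet> v \<le> b" if v: "v \<in> ?V" for v
    proof -
      obtain R T where "v = vertex ends R T" "indep \<I> R"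
        using v by blast
      with switched[of R T] cycle_ineq_le[of R "sym_diff T Y"] show ?thesis by simp
    qed
    \<comment> \<open>The strict and the tight witness of the original inequality, moved by
      complementation within \<open>Y\<close>.\<close>
    show "vertex ends {} (sym_diff {j 2} Y) \<in> ?V" "vertex ends {} Y \<in> ?V"
      using indep_empty by blast+
    show "a \<bullet> vertex ends {} (sym_diff {j 2} Y) \<noteq> b"
      using switched[of "{}" "sym_diff {j 2} Y"] cycle_ineq_strict unfolding sym_diff by simp
    show "a \<bullet> vertex ends {} Y = b"
      using switched[of "{}" Y] cycle_ineq_tight[OF tight_empty] by simp
  next
    fix c d
    assume const: "\<And>v. \<lbrakk>v \<in> ?V; a \<bullet> v = b\<rbrakk> \<Longrightarrow> c \<bullet> v = d"
      and u: "c \<bullet> (0, axis (j 2) 1, 0) = 0"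
    \<comment> \<open>Switching \<open>(c, d)\<close> as well turns constancy on the switched tight
      vertices into constancy on the original ones; the coefficient at \<open>j 2\<close> changes at
      most its sign, so it stays 0.\<close>
    have "tight_form ends \<I> m I j S (fst (switching ends Y (c, d))) (snd (switching ends Y (c, d)))"
    proof unfold_locales
      fix R T assume tight: "tight R T"
      have "a \<bullet> vertex ends R (sym_diff T Y) = b"
        using switched[of R "sym_diff T Y"] cycle_ineq_tight[OF tight] unfolding sym_diff by simp
      then have "c \<bullet> vertex ends R (sym_diff T Y) = d"
        using tight by (intro const) (auto simp: tight_def)
      then show "fst (switching ends Y (c, d)) \<bullet> vertex ends R T = snd (switching ends Y (c, d))"
        using switching_inner_vertex[OF inj_ends, of Y c d R T] by simp
    next
      show "fst (snd (fst (switching ends Y (c, d)))) $ j 2 = 0"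
        using u by (cases c) (auto simp: switching_def inner_axis)
    qed
    then show "c = 0"
      using tight_form.coefficients_zero fst_switching_eq_0D by blast
  qed
  then show ?thesis
    by (simp add: ab P_poly_eq)
qed

end

theorem theorem3p7:
  fixes ends :: "'e::finite \<Rightarrow> 'x::finite \<times> 'y::finite"
    and \<I> :: "'x set set"
    and m :: nat
    and I :: "nat \<Rightarrow> 'x set"
    and j :: "nat \<Rightarrow> 'y"
    and S :: "nat \<Rightarrow> 'x set"
  assumes "inj ends"
    and "partition_on UNIV \<I>"
    and "subset_uniform ends \<I>"
    and "m \<ge> 2"
    and "simple_chordless_cycle (dep_edges ends \<I>) m I j"
    and "\<forall>p\<in>{1..m}. S p \<subseteq> I p \<and> S p \<noteq> {}"
  shows "defines_facet (cycle_ineq ends m j S) (P_poly ends \<I>) \<and>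
         (\<forall>Yh. defines_facet (switching ends Yh (cycle_ineq ends m j S)) (P_poly ends \<I>))"
proof -
  interpret dependency_cycle ends \<I> m I j S
    by (rule dependency_cycle.intro) fact+
  show ?thesis
    using switching_defines_facet[of "{}"] switching_defines_facet by simp
qed

end
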